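(* Let $n\ge1$ and let $a_1,\dots,a_{n-1},b_1,\dots,b_{n-1}$ be complex parameters of modulus strictly less than $1$. For any partition $\lambda=(\lambda_1,\dots,\lambda_n)\in\mathbb{Y}_n$ with $\lambda_n>0$, $$\mathsf f_{(\lambda_1,\dots,\lambda_n)}(x_1,\dots,x_n|a_1,\dots,a_{n-1};b_1,\dots,b_{n-1})=(x_1\cdots x_n)\,\mathsf f_{(\lambda_1-1,\dots,\lambda_n-1)}(x_1,\dots,x_n|a_1,\dots,a_{n-1};b_1,\dots,b_{n-1}).$$
   Context: Let $q\in\mathbb{C}$ with $|q|<1$, and $(z;q)_k=\prod_{i=0}^{k-1}(1-zq^i)$ for $k\in\mathbb{Z}_{\ge0}$. $\mathbb{Y}_n$ is the set of integer partitions $\lambda=(\lambda_1\ge\dots\ge\lambda_n\ge0)$ with at most $n$ nonzero parts, with $\lambda_i=0$ for $i>n$; $|\lambda|=\sum_i\lambda_i$. For partitions, $\mu\preceq\lambda$ means $\lambda_i\ge\mu_i\ge\lambda_{i+1}$ for all $i\ge1$. Spin $q$-Whittaker polynomials: let $c_1,\dots,c_n,d_1,\dots,d_n$ be complex parameters of modulus $<1$. For $\lambda\in\mathbb{Y}_n$, $\mu\in\mathbb{Y}_{n-1}$ set $$\mathbb{F}_{\lambda/\mu}(x|c_1,\dots,c_n;d_1,\dots,d_n)=\mathbf 1_{\mu\preceq\lambda}\,x^{|\lambda|-|\mu|}\prod_{r=1}^n\frac{(c_r/x;q)_{\lambda_r-\mu_r}(xd_r;q)_{\mu_r-\lambda_{r+1}}(q;q)_{\lambda_r-\lambda_{r+1}}}{(q;q)_{\lambda_r-\mu_r}(q;q)_{\mu_r-\lambda_{r+1}}(c_rd_r;q)_{\lambda_r-\lambda_{r+1}}}.$$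 Define recursively, starting from $\mathbb{F}_\varnothing=1$ in zero variables, $$\mathbb{F}_\lambda(x_1,\dots,x_n|c_1,\dots,c_n;d_1,\dots,d_n)=\sum_{\mu\in\mathbb{Y}_{n-1},\,\mu\preceq\lambda}\mathbb{F}_\mu(x_1,\dots,x_{n-1}|c_2,\dots,c_n;d_1,\dots,d_{n-1})\,\mathbb{F}_{\lambda/\mu}(x_n|c_1,\dots,c_n;d_1,\dots,d_n).$$ These are polynomials, known to be symmetric in $x_1,\dots,x_n$. Set $$\mathsf f_\lambda(x_1,\dots,x_n|c_1,\dots,c_{n-1};d_1,\dots,d_{n-1})=\mathbb{F}_\lambda(x_1,\dots,x_n|c_1,\dots,c_{n-1},0;d_1,\dots,d_n),$$ which does not depend on $d_n$. *)

theory Defs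
  imports Complex_Main "HOL-Computational_Algebra.Polynomial"
begin

text \<open>
  Conventions.  All indices start at 0: the part \<open>\<lambda>\<^sub>r\<close>, the variable \<open>x\<^sub>r\<close> and the parameters
  \<open>c\<^sub>r, d\<^sub>r\<close> of the usual notation (\<open>r \<ge> 1\<close>) are \<open>lam (r - 1)\<close>, \<open>x (r - 1)\<close>, \<open>c (r - 1)\<close>,
  \<open>d (r - 1)\<close>.  Finite tuples of complex numbers are functions on \<open>nat\<close> of which only the first
  entries matter; partitions are functions on \<open>nat\<close> which really are eventually 0.
\<close>

definition qpoch :: "complex \<Rightarrow> complex \<Rightarrow> nat \<Rightarrow> complex" where
  "qpoch z q k = (\<Prod>i<k. 1 - z * q ^ i)"

definition partitions :: "nat \<Rightarrow> (nat \<Rightarrow> nat) set" where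
  "partitions n = {lam. antimono lam \<and> (\<forall>i\<ge>n. lam i = 0)}"

definition psize :: "(nat \<Rightarrow> nat) \<Rightarrow> nat" where
  "psize lam = (\<Sum>i | lam i \<noteq> 0. lam i)"

definition interlaces :: "(nat \<Rightarrow> nat) \<Rightarrow> (nat \<Rightarrow> nat) \<Rightarrow> bool" where
  "interlaces mu lam \<longleftrightarrow> (\<forall>i. mu i \<le> lam i \<and> lam (Suc i) \<le> mu i)"

text \<open>
  The defining formula of the skew function in one variable.  The natural number subtractions are
  exact whenever the indicator is 1.  Because of \<open>c r / x\<close>, the formula is meaningful only
  for \<open>x \<noteq> 0\<close>.
\<close>

definition skew_formula ::
  "complex \<Rightarrow> nat \<Rightarrow> (nat \<Rightarrow> nat) \<Rightarrow> (nat \<Rightarrow> nat) \<Rightarrow> (nat \<Rightarrow> complex) \<Rightarrow> (nat \<Rightarrow> complex) \<Rightarrow> complex \<Rightarrow> complex"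
  where
  "skew_formula q n lam mu c d x =
     of_bool (interlaces mu lam) * x ^ (psize lam - psize mu) *
     (\<Prod>r<n. (qpoch (c r / x) q (lam r - mu r) * qpoch (x * d r) q (mu r - lam (Suc r))
                * qpoch q q (lam r - lam (Suc r)))
            / (qpoch q q (lam r - mu r) * qpoch q q (mu r - lam (Suc r))
                * qpoch (c r * d r) q (lam r - lam (Suc r))))"

text \<open>
  The formula is a polynomial in \<open>x\<close> (see \<open>skew_formula_polynomial\<close> below); taking that polynomial
  gives the correct value at \<open>x = 0\<close> too.
\<close>

definition spin_whittaker_skew ::
  "complex \<Rightarrow> nat \<Rightarrow> (nat \<Rightarrow> nat) \<Rightarrow> (nat \<Rightarrow> nat) \<Rightarrow> (nat \<Rightarrow> complex) \<Rightarrow> (nat \<Rightarrow> complex) \<Rightarrow> complex poly"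
  where
  "spin_whittaker_skew q n lam mu c d =
     (THE p. \<forall>x. x \<noteq> 0 \<longrightarrow> poly p x = skew_formula q n lam mu c d x)"

primrec spin_whittaker ::
  "complex \<Rightarrow> nat \<Rightarrow> (nat \<Rightarrow> nat) \<Rightarrow> (nat \<Rightarrow> complex) \<Rightarrow> (nat \<Rightarrow> complex) \<Rightarrow> (nat \<Rightarrow> complex) \<Rightarrow> complex"
  where
  "spin_whittaker q 0 lam x c d = 1"
| "spin_whittaker q (Suc n) lam x c d =
     (\<Sum>mu \<in> {mu \<in> partitions n. interlaces mu lam}.
        spin_whittaker q n mu x (\<lambda>i. c (Suc i)) d
        * poly (spin_whittaker_skew q (Suc n) lam mu c d) (x n))"

text \<open>
  In \<open>n\<close> variables only the first \<open>n - 1\<close> entries of \<open>a\<close> and \<open>b\<close> are used: the last \<open>c\<close>-parameter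
  is 0, and the last \<open>d\<close>-parameter is irrelevant (see \<open>spin_whittaker_f_eq\<close> below).
\<close>

definition spin_whittaker_f ::
  "complex \<Rightarrow> nat \<Rightarrow> (nat \<Rightarrow> nat) \<Rightarrow> (nat \<Rightarrow> complex) \<Rightarrow> (nat \<Rightarrow> complex) \<Rightarrow> (nat \<Rightarrow> complex) \<Rightarrow> complex"
  where
  "spin_whittaker_f q n lam x a b =
     spin_whittaker q n lam x (a(n - 1 := 0)) (b(n - 1 := 0))"


lemma psize_eq:
  assumes "lam \<in> partitions n"
  shows "psize lam = (\<Sum>i<n. lam i)"
  unfolding psize_def
  by (rule sum.mono_neutral_left) (use assms in \<open>auto simp: partitions_def not_less[symmetric]\<close>)

lemma partitions_mono: "m \<le> n \<Longrightarrow> partitions m \<subseteq> partitions n"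
  by (auto simp: partitions_def)

lemma finite_interlacing: "finite {mu \<in> partitions n. interlaces mu lam}"
proof (rule finite_subset)
  show "{mu \<in> partitions n. interlaces mu lam}
          \<subseteq> {f. \<forall>i. (i \<in> {..<n} \<longrightarrow> f i \<in> {..Max (lam ` {..<n})}) \<and> (i \<notin> {..<n} \<longrightarrow> f i = 0)}"
    by (auto simp: partitions_def interlaces_def intro: order_trans Max_ge)
  show "finite {f. \<forall>i. (i \<in> {..<n} \<longrightarrow> f i \<in> {..Max (lam ` {..<n})}) \<and> (i \<notin> {..<n} \<longrightarrow> f i = 0)}"
    by (rule finite_set_of_finite_funs) auto
qed

lemma poly_eq_if_eq_nonzero:
  fixes p p' :: "complex poly"
  assumes "\<And>x. x \<noteq> 0 \<Longrightarrow> poly p x = poly p' x"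
  shows "p = p'"
proof -
  have "poly ([:0, 1:] * p) = poly ([:0, 1:] * p')"
    using assms by (auto simp: fun_eq_iff)
  thus ?thesis
    by (simp only: poly_eq_poly_eq_iff mult_cancel_left) auto
qed

lemma skew_formula_polynomial:
  assumes "lam \<in> partitions n" "mu \<in> partitions n"
  shows "\<exists>!p. \<forall>x. x \<noteq> 0 \<longrightarrow> poly p x = skew_formula q n lam mu c d x"
proof -
  define K where "K r = qpoch q q (lam r - lam (Suc r)) /
     (qpoch q q (lam r - mu r) * qpoch q q (mu r - lam (Suc r))
                * qpoch (c r * d r) q (lam r - lam (Suc r)))" for r
  define P where "P r = (\<Prod>i<lam r - mu r. [:- (c r * q ^ i), 1:])
     * (\<Prod>i<mu r - lam (Suc r). [:1, - (d r * q ^ i):]) * [:K r:]" for r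
  define p where "p = of_bool (interlaces mu lam) * (\<Prod>r<n. P r)"
  have "poly p x = skew_formula q n lam mu c d x" if x: "x \<noteq> 0" for x
  proof (cases "interlaces mu lam")
    case True
    have "psize lam - psize mu = (\<Sum>r<n. lam r - mu r)"
      using True assms by (simp add: psize_eq interlaces_def sum_subtractf_nat)
    hence pw: "x ^ (psize lam - psize mu) = (\<Prod>r<n. x ^ (lam r - mu r))"
      by (simp add: power_sum)
    have c: "x ^ k * qpoch (c r / x) q k = (\<Prod>i<k. x - c r * q ^ i)" for r k
      using x by (induction k) (simp_all add: qpoch_def field_simps)
    have P: "poly (P r) x = x ^ (lam r - mu r) *
       ((qpoch (c r / x) q (lam r - mu r) * qpoch (x * d r) q (mu r - lam (Suc r))
                * qpoch q q (lam r - lam (Suc r)))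
            / (qpoch q q (lam r - mu r) * qpoch q q (mu r - lam (Suc r))
                * qpoch (c r * d r) q (lam r - lam (Suc r))))" for r
    proof -
      have "poly (P r) x = (\<Prod>i<lam r - mu r. x - c r * q ^ i)
              * qpoch (x * d r) q (mu r - lam (Suc r)) * K r"
        by (simp add: P_def poly_prod qpoch_def algebra_simps)
      thus ?thesis by (simp add: c[symmetric] K_def)
    qed
    show ?thesis
      using True by (simp add: p_def skew_formula_def poly_prod P pw prod.distrib[symmetric])
  qed (simp add: p_def skew_formula_def)
  thus ?thesis
    by (intro ex1I[of _ p]) (auto intro: poly_eq_if_eq_nonzero)
qed

lemma poly_spin_whittaker_skew:
  assumes "lam \<in> partitions n" "mu \<in> partitions n" "x \<noteq> 0"
  shows "poly (spin_whittaker_skew q n lam mu c d) x = skew_formula q n lam mu c d x"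
  using theI'[OF skew_formula_polynomial[OF assms(1,2)]] assms(3)
  unfolding spin_whittaker_skew_def by blast

lemma spin_whittaker_Suc_nonzero:
  assumes "lam \<in> partitions (Suc n)" "x n \<noteq> 0"
  shows "spin_whittaker q (Suc n) lam x c d =
     (\<Sum>mu \<in> {mu \<in> partitions n. interlaces mu lam}.
        spin_whittaker q n mu x (\<lambda>i. c (Suc i)) d * skew_formula q (Suc n) lam mu c d (x n))"
  using assms partitions_mono[of n "Suc n"]
  by (auto simp: poly_spin_whittaker_skew subset_iff intro!: sum.cong)

lemma spin_whittaker_cong_d:
  assumes "\<And>i. i < n \<Longrightarrow> d i = d' i"
  shows "spin_whittaker q n lam x c d = spin_whittaker q n lam x c d'"
  using assms
proof (induction n arbitrary: lam c)
  case (Suc n)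
  have "skew_formula q (Suc n) lam mu c d = skew_formula q (Suc n) lam mu c d'" for mu
    using Suc.prems by (auto simp: fun_eq_iff skew_formula_def intro!: prod.cong)
  hence "spin_whittaker_skew q (Suc n) lam mu c d = spin_whittaker_skew q (Suc n) lam mu c d'" for mu
    by (simp add: spin_whittaker_skew_def)
  thus ?case using Suc by simp
qed simp

lemma spin_whittaker_f_eq:
  assumes lam: "lam \<in> partitions n"
  shows "spin_whittaker q n lam x (a(n - 1 := 0)) (b(n - 1 := t)) = spin_whittaker_f q n lam x a b"
proof (cases n)
  case (Suc m)
  have sk: "skew_formula q n lam mu (a(m := 0)) (b(m := t)) =
        skew_formula q n lam mu (a(m := 0)) (b(m := 0))" if "mu \<in> partitions m" for mu
  proof -
    have "mu m = 0" using that by (simp add: partitions_def)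
    hence tail: "mu m - lam (Suc m) = 0"
      by simp
    show ?thesis
      unfolding skew_formula_def
      by (intro ext arg_cong2[of _ _ _ _ "(*)"] prod.cong refl)
         (use tail in \<open>auto simp: fun_upd_def qpoch_def\<close>)
  qed
  have eq: "spin_whittaker q m mu x c (b(m := t)) = spin_whittaker q m mu x c (b(m := 0))" for mu c
    by (rule spin_whittaker_cong_d) simp
  show ?thesis
    unfolding spin_whittaker_f_def Suc
    by (auto simp: eq spin_whittaker_skew_def sk[unfolded Suc] intro!: sum.cong)
qed (simp add: spin_whittaker_f_def)

end

theory Submission
  imports Defs
begin

text \<open>
  Removing a full column from \<open>lam\<close> pulls out one factor of each variable because the branching
  rule almost only sees differences.  In the step from \<open>n + 1\<close> to \<open>n\<close> variables every interlacing
  \<open>mu\<close> satisfies \<open>mu i \<ge> lam n > 0\<close> for \<open>i < n\<close>, so a column can be removed from \<open>mu\<close> as well, and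
  this matches the partitions interlacing with \<open>lam\<close> with those interlacing with the lowered \<open>lam\<close>.
  The factors \<open>r < n\<close> of the skew function depend only on \<open>lam r - mu r\<close>, \<open>mu r - lam (r + 1)\<close> and
  \<open>lam r - lam (r + 1)\<close> and do not change.  In the factor \<open>r = n\<close> the part \<open>lam n\<close> itself occurs,
  since \<open>mu n = 0\<close>; but as the last \<open>c\<close>-parameter vanishes, this factor reduces to
  \<open>(q;q)\<^sub>k / (q;q)\<^sub>k = 1\<close> with \<open>k = lam n\<close>.  Finally \<open>lam\<close> loses one box more than \<open>mu\<close>, which is the
  factor \<open>x n\<close> (\<open>spin_whittaker_skew_remove_column\<close>).

  The parameters passed to the inner function are \<open>c 1, \<dots>, c n\<close>, again with a vanishing last entry,
  so induction on the number of variables applies (\<open>spin_whittaker_remove_column\<close>).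
\<close>

definition remove_column :: "nat \<Rightarrow> (nat \<Rightarrow> nat) \<Rightarrow> nat \<Rightarrow> nat" where
  "remove_column n lam = (\<lambda>i. if i < n then lam i - 1 else 0)"

definition add_column :: "nat \<Rightarrow> (nat \<Rightarrow> nat) \<Rightarrow> nat \<Rightarrow> nat" where
  "add_column n lam = (\<lambda>i. if i < n then lam i + 1 else 0)"

lemma remove_column_partitions:
  "lam \<in> partitions n \<Longrightarrow> remove_column n lam \<in> partitions n"
  by (auto simp: partitions_def remove_column_def antimono_def diff_le_mono)

lemma add_column_partitions:
  "lam \<in> partitions n \<Longrightarrow> add_column n lam \<in> partitions n"
  by (auto simp: partitions_def add_column_def antimono_def)

lemma remove_add_column:
  "lam \<in> partitions n \<Longrightarrow> remove_column n (add_column n lam) = lam"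
  by (auto simp: partitions_def add_column_def remove_column_def)

lemma add_remove_column:
  "lam \<in> partitions n \<Longrightarrow> (\<And>i. i < n \<Longrightarrow> 0 < lam i) \<Longrightarrow> add_column n (remove_column n lam) = lam"
  by (auto simp: partitions_def add_column_def remove_column_def fun_eq_iff)

lemma psize_remove_column:
  assumes "lam \<in> partitions n" "\<And>i. i < n \<Longrightarrow> 0 < lam i"
  shows "psize lam = psize (remove_column n lam) + n"
proof -
  have "(\<Sum>i<n. lam i) = (\<Sum>i<n. remove_column n lam i + 1)"
    using assms(2) by (intro sum.cong) (auto simp: remove_column_def)
  also have "\<dots> = (\<Sum>i<n. remove_column n lam i) + n"
    by (subst sum.distrib) simp
  finally show ?thesis
    by (simp add: psize_eq[OF assms(1)] psize_eq[OF remove_column_partitions[OF assms(1)]])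
qed

lemma interlaces_pos:
  assumes "interlaces mu lam" "\<And>i. i < Suc n \<Longrightarrow> 0 < lam i" "i < n"
  shows "0 < mu i"
  using assms(1) assms(2)[of "Suc i"] assms(3) unfolding interlaces_def
  by (meson Suc_less_eq less_le_trans)

lemma interlaces_remove_column:
  assumes "interlaces mu lam"
  shows "interlaces (remove_column n mu) (remove_column (Suc n) lam)"
  using assms by (auto simp: interlaces_def remove_column_def diff_le_mono)

text \<open>
  Positivity of \<open>lam\<close> is used at the upper bound \<open>mu i + 1 \<le> lam i\<close>: where \<open>lam i = 0\<close> the
  truncated difference \<open>lam i - 1\<close> would still admit \<open>mu i = 0\<close>.
\<close>

lemma interlaces_add_column:
  assumes lam: "lam \<in> partitions (Suc n)" "\<And>i. i < Suc n \<Longrightarrow> 0 < lam i"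
    and il: "interlaces mu (remove_column (Suc n) lam)"
  shows "interlaces (add_column n mu) lam"
  unfolding interlaces_def
proof
  fix i
  have "mu i \<le> remove_column (Suc n) lam i" "remove_column (Suc n) lam (Suc i) \<le> mu i"
    using il by (auto simp: interlaces_def)
  moreover have "n \<le> i \<Longrightarrow> lam (Suc i) = 0"
    using lam(1) by (simp add: partitions_def)
  ultimately show "add_column n mu i \<le> lam i \<and> lam (Suc i) \<le> add_column n mu i"
    using lam(2)[of i] by (auto simp: remove_column_def add_column_def split: if_splits)
qed

lemma qpoch_q_q_nonzero:
  assumes "norm q < 1"
  shows "qpoch q q k \<noteq> 0"
proof -
  have "q * q ^ i \<noteq> 1" for i
  proof
    assume "q * q ^ i = 1"
    hence "norm q ^ Suc i = 1"
      by (metis norm_one norm_power power_Suc)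
    moreover have "norm q ^ Suc i < 1"
      using assms power_decreasing[of 1 "Suc i" "norm q"] by simp
    ultimately show False by simp
  qed
  thus ?thesis by (simp add: qpoch_def)
qed

text \<open>
  Stated for polynomials rather than for values of the formula, so that it can be evaluated at 0
  as well, where \<open>c r / x\<close> makes no sense.
\<close>

lemma spin_whittaker_skew_remove_column:
  assumes q: "norm q < 1" and c: "c n = 0"
    and lam: "lam \<in> partitions (Suc n)" "\<And>i. i < Suc n \<Longrightarrow> 0 < lam i"
    and mu: "mu \<in> partitions n" and il: "interlaces mu lam"
  shows "spin_whittaker_skew q (Suc n) lam mu c d =
           [:0, 1:] * spin_whittaker_skew q (Suc n) (remove_column (Suc n) lam) (remove_column n mu) c d"
proof (rule poly_eq_if_eq_nonzero)
  fix x :: complex assume x: "x \<noteq> 0"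
  let ?lam = "remove_column (Suc n) lam" and ?mu = "remove_column n mu"
  have mu_pos: "0 < mu i" if "i < n" for i
    using interlaces_pos[OF il lam(2) that] .
  have il': "interlaces ?mu ?lam"
    using il by (rule interlaces_remove_column)
  have lam': "?lam \<in> partitions (Suc n)"
    using lam(1) by (rule remove_column_partitions)
  have mu': "?mu \<in> partitions n"
    using mu by (rule remove_column_partitions)
  have mu_Suc: "mu \<in> partitions (Suc n)" "?mu \<in> partitions (Suc n)"
    using mu mu' partitions_mono[of n "Suc n"] by auto
  have "psize ?mu \<le> psize ?lam"
    unfolding psize_eq[OF lam'] psize_eq[OF mu_Suc(2)]
    using il' by (intro sum_mono) (simp add: interlaces_def)
  hence size: "psize lam - psize mu = Suc (psize ?lam - psize ?mu)"
    using psize_remove_column[OF lam] psize_remove_column[OF mu mu_pos] by simp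
  define G where "G l m r = (qpoch (c r / x) q (l r - m r) * qpoch (x * d r) q (m r - l (Suc r))
                * qpoch q q (l r - l (Suc r)))
            / (qpoch q q (l r - m r) * qpoch q q (m r - l (Suc r))
                * qpoch (c r * d r) q (l r - l (Suc r)))" for l m :: "nat \<Rightarrow> nat" and r
  (* For r = n both l n - m n and l n - l (n + 1) equal l n and do change when the columns are
     removed; their contributions cancel. *)
  have G_last: "G l m n = 1" if "l \<in> partitions (Suc n)" "m \<in> partitions n" for l m
    using that c qpoch_q_q_nonzero[OF q]
    by (simp add: G_def partitions_def qpoch_def[of 0] qpoch_def[of _ _ 0])
  have G_less: "G lam mu r = G ?lam ?mu r" if r: "r < n" for r
  proof -
    have "?lam r - ?mu r = lam r - mu r" "?mu r - ?lam (Suc r) = mu r - lam (Suc r)"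
      "?lam r - ?lam (Suc r) = lam r - lam (Suc r)"
      using r lam(2)[of r] lam(2)[of "Suc r"] mu_pos[OF r] by (auto simp: remove_column_def)
    thus ?thesis by (simp add: G_def)
  qed
  have prod: "(\<Prod>r<Suc n. G lam mu r) = (\<Prod>r<Suc n. G ?lam ?mu r)"
    by (simp add: G_last lam(1) mu lam' mu' G_less)
  have "skew_formula q (Suc n) lam mu c d x = x * skew_formula q (Suc n) ?lam ?mu c d x"
    using prod il il' by (simp only: skew_formula_def G_def[symmetric] size) simp
  thus "poly (spin_whittaker_skew q (Suc n) lam mu c d) x =
          poly ([:0, 1:] * spin_whittaker_skew q (Suc n) ?lam ?mu c d) x"
    using x lam(1) lam' mu_Suc by (simp add: poly_spin_whittaker_skew)
qed

text \<open>
  The induction runs over general \<open>c\<close> whose last relevant entry is 0, because this condition, unlike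
  the special form \<open>a(n - 1 := 0)\<close>, visibly survives the shift of \<open>c\<close> in the branching rule.
\<close>

lemma spin_whittaker_remove_column:
  assumes "norm q < 1" "n > 0 \<Longrightarrow> c (n - 1) = 0"
    and "lam \<in> partitions n" "\<And>i. i < n \<Longrightarrow> 0 < lam i"
  shows "spin_whittaker q n lam x c d =
           (\<Prod>i<n. x i) * spin_whittaker q n (remove_column n lam) x c d"
  using assms(2-)
proof (induction n arbitrary: lam c)
  case (Suc n)
  let ?lam = "remove_column (Suc n) lam" and ?c = "\<lambda>i. c (Suc i)"
  have "spin_whittaker q (Suc n) lam x c d =
     (\<Sum>mu \<in> {mu \<in> partitions n. interlaces mu lam}.
        spin_whittaker q n mu x ?c d * poly (spin_whittaker_skew q (Suc n) lam mu c d) (x n))"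
    by simp
  also have "\<dots> = (\<Sum>mu \<in> {mu \<in> partitions n. interlaces mu ?lam}.
        (\<Prod>i<Suc n. x i) * (spin_whittaker q n mu x ?c d
          * poly (spin_whittaker_skew q (Suc n) ?lam mu c d) (x n)))"
  proof (rule sum.reindex_bij_witness[of _ "add_column n" "remove_column n"])
    fix mu assume "mu \<in> {mu \<in> partitions n. interlaces mu lam}"
    hence mu: "mu \<in> partitions n" "interlaces mu lam" by auto
    have mu_pos: "0 < mu i" if "i < n" for i
      using interlaces_pos[OF mu(2) Suc.prems(3) that] .
    show "add_column n (remove_column n mu) = mu"
      using mu(1) mu_pos by (rule add_remove_column)
    show "remove_column n mu \<in> {mu \<in> partitions n. interlaces mu ?lam}"
      using mu by (simp add: remove_column_partitions interlaces_remove_column)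
    have "spin_whittaker q n mu x ?c d =
        (\<Prod>i<n. x i) * spin_whittaker q n (remove_column n mu) x ?c d"
      using Suc.prems(1) mu(1) mu_pos by (intro Suc.IH) auto
    moreover have "spin_whittaker_skew q (Suc n) lam mu c d =
        [:0, 1:] * spin_whittaker_skew q (Suc n) ?lam (remove_column n mu) c d"
      using Suc.prems mu by (intro spin_whittaker_skew_remove_column assms(1)) auto
    ultimately show "(\<Prod>i<Suc n. x i) * (spin_whittaker q n (remove_column n mu) x ?c d
          * poly (spin_whittaker_skew q (Suc n) ?lam (remove_column n mu) c d) (x n)) =
        spin_whittaker q n mu x ?c d * poly (spin_whittaker_skew q (Suc n) lam mu c d) (x n)"
      by simp
  next
    fix mu assume "mu \<in> {mu \<in> partitions n. interlaces mu ?lam}"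
    hence mu: "mu \<in> partitions n" "interlaces mu ?lam" by auto
    show "remove_column n (add_column n mu) = mu"
      using mu(1) by (rule remove_add_column)
    show "add_column n mu \<in> {mu \<in> partitions n. interlaces mu lam}"
      using interlaces_add_column[OF Suc.prems(2,3) mu(2)] mu(1)
      by (simp add: add_column_partitions)
  qed
  also have "\<dots> = (\<Prod>i<Suc n. x i) * spin_whittaker q (Suc n) ?lam x c d"
    by (simp add: sum_distrib_left)
  finally show ?case .
qed simp

theorem proposition2p2:
  fixes q :: complex and n :: nat and a b x :: "nat \<Rightarrow> complex" and lam :: "nat \<Rightarrow> nat"
  assumes "norm q < 1"
    and "n \<ge> 1"
    and "\<And>i. i < n - 1 \<Longrightarrow> norm (a i) < 1"
    and "\<And>i. i < n - 1 \<Longrightarrow> norm (b i) < 1"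
    and "lam \<in> partitions n"
    and "lam (n - 1) > 0"
  shows "spin_whittaker_f q n lam x a b =
           (\<Prod>i<n. x i) * spin_whittaker_f q n (\<lambda>i. if i < n then lam i - 1 else 0) x a b"
proof -
  have "0 < lam i" if "i < n" for i
  proof -
    have "lam (n - 1) \<le> lam i"
      using assms(5) that by (auto simp: partitions_def antimono_def)
    thus ?thesis using assms(6) by simp
  qed
  thus ?thesis
    unfolding spin_whittaker_f_def remove_column_def[symmetric]
    using assms(1,5) by (intro spin_whittaker_remove_column) auto
qed

end
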